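(* Let $\vec c=(c_1,c_2,\dots)$ be a sequence of nonnegative reals and fix $j\ge 1$. If $c_j\ge c_{j+1}$ and $c_j\ne 0$, then the Markov operator $L^{(j)}_{c_{j+1}/c_j}$ maps $\mathfrak{G}_{\vec c}$ to $\mathfrak{G}_{s_j\vec c}$. If $c_j\le c_{j+1}$ and $c_{j+1}\ne 0$, then the Markov operator $R^{(j)}_{c_j/c_{j+1}}$ maps $\mathfrak{G}_{\vec c}$ to $\mathfrak{G}_{s_j\vec c}$.
   Context: Partitions are weakly decreasing sequences $\lambda=(\lambda_1\ge\lambda_2\ge\dots\ge 0)$ of integers with finitely many nonzero parts; $|\lambda|=\sum_i\lambda_i$. Write $\varkappa\prec\lambda$ if $\lambda_1\ge\varkappa_1\ge\lambda_2\ge\varkappa_2\ge\cdots$. Let $s_{\lambda/\varkappa}(x)=x^{|\lambda|-|\varkappa|}\mathbf{1}_{\varkappa\prec\lambda}$ be the one-variable skew Schur polynomial, $s_\lambda(x)=s_{\lambda/\varnothing}(x)$, and let $s_\lambda(x_1,\dots,x_N)$ be the Schur polynomial, so that $s_\lambda(x_1,\dots,x_N)=\sum_{\lambda^{(1)}\prec\dots\prec\lambda^{(N)}=\lambda}s_{\lambda^{(1)}}(x_1)s_{\lambda^{(2)}/\lambda^{(1)}}(x_2)\cdots s_{\lambda^{(N)}/\lambda^{(N-1)}}(x_N)$ (sum over interlacing sequences with $\lambda^{(1)}$ having at most one nonzero part). $\mathcal{S}$ is the set of infinite interlacing arrays $\varnothing=\lambda^{(0)}\prec\lambda^{(1)}\prec\lambda^{(2)}\prec\cdots$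 of partitions (so $\lambda^{(j)}$ has at most $j$ nonzero parts). A probability measure on $\mathcal{S}$ is called $\vec c$-Gibbs if for every $N$, given $\lambda^{(N)}=\lambda$, the conditional probability of $(\lambda^{(1)},\dots,\lambda^{(N-1)})$ equals $$\frac{s_{\lambda^{(1)}}(c_1)s_{\lambda^{(2)}/\lambda^{(1)}}(c_2)\cdots s_{\lambda^{(N-1)}/\lambda^{(N-2)}}(c_{N-1})\,s_{\lambda/\lambda^{(N-1)}}(c_N)}{s_\lambda(c_1,\dots,c_N)}.$$ $\mathfrak{G}_{\vec c}$ is the set of all $\vec c$-Gibbs measures. $s_j\vec c$ is the sequence obtained from $\vec c$ by swapping $c_j$ and $c_{j+1}$. For $A\in\mathbb{Z}_{\ge 0}$ and $\alpha\in[0,1]$, the truncated geometric random variable $Y_\alpha(A)$ on $\{0,1,\dots,A\}$ has $\mathrm{Prob}(Y_\alpha(A)=k)=(1-\alpha)\alpha^k$ for $0\le k\le A-1$ and $\mathrm{Prob}(Y_\alpha(A)=A)=\alpha^A$ (with $0^0=1$). For $\alpha\in[0,1]$ and $j\ge 1$, with the conventions $\lambda^{(i)}_0=\infty$ and $\lambda^{(i)}_{i+1}=0$ for all $i\ge 0$, the Markov maps $L^{(j)}_\alpha$ and $R^{(j)}_\alpha$ on $\mathcal{S}$ leave all $\lambda^{(i)}$, $i\ne j$, unchanged and randomly replace $\lambda^{(j)}$ as follows: $$L^{(j)}_\alpha:\ \lambda^{(j)}_k\mapsto \max\{\lambda^{(j-1)}_k,\lambda^{(j+1)}_{k+1}\}+Y^{(k)},\qquad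 k=1,\dots,j,$$ where the $Y^{(k)}$ are independent and $Y^{(k)}$ is distributed as $Y_\alpha\bigl(\lambda^{(j)}_k-\max\{\lambda^{(j-1)}_k,\lambda^{(j+1)}_{k+1}\}\bigr)$; $$R^{(j)}_\alpha:\ \lambda^{(j)}_k\mapsto \min\{\lambda^{(j-1)}_{k-1},\lambda^{(j+1)}_{k}\}-Y^{(k)},\qquad k=1,\dots,j,$$ where the $Y^{(k)}$ are independent and $Y^{(k)}$ is distributed as $Y_\alpha\bigl(\min\{\lambda^{(j-1)}_{k-1},\lambda^{(j+1)}_{k}\}-\lambda^{(j)}_k\bigr)$. A Markov map acts on probability measures on $\mathcal{S}$ by sending the law of the array to the law of the updated array. *)

theory Defs
  imports "HOL-Probability.Probability"
begin

section \<open>Partitions and Schur polynomials\<close>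

text \<open>
  Parts are indexed from 0: \<open>lam i\<close> is the part usually written $\lambda_{i+1}$.
\<close>

definition partitions :: "(nat \<Rightarrow> nat) set" where
  "partitions = {lam. antimono lam \<and> finite {i. lam i \<noteq> 0}}"

abbreviation empty_part :: "nat \<Rightarrow> nat" where
  "empty_part \<equiv> (\<lambda>_. 0)"

definition psize :: "(nat \<Rightarrow> nat) \<Rightarrow> nat" where
  "psize lam = (\<Sum>i | lam i \<noteq> 0. lam i)"

definition interlace :: "(nat \<Rightarrow> nat) \<Rightarrow> (nat \<Rightarrow> nat) \<Rightarrow> bool" (infix "\<prec>\<prec>" 50) where
  "kap \<prec>\<prec> lam \<longleftrightarrow> (\<forall>i. kap i \<le> lam i \<and> lam (Suc i) \<le> kap i)"

text \<open>
  \<open>skew_schur1 lam kap x\<close> is $s_{\lambda/\varkappa}(x)$. Interlacing implies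
  \<open>psize kap \<le> psize lam\<close>, so the subtraction does not truncate; \<open>0 ^ 0 = 1\<close>.
\<close>

definition skew_schur1 :: "(nat \<Rightarrow> nat) \<Rightarrow> (nat \<Rightarrow> nat) \<Rightarrow> real \<Rightarrow> real" where
  "skew_schur1 lam kap x = (if kap \<prec>\<prec> lam then x ^ (psize lam - psize kap) else 0)"

text \<open>
  A sequence $\lambda^{(0)},\dots,\lambda^{(N)}$ is a function on \<open>{0..N}\<close>
  (extensional, so that distinct functions are distinct sequences).
\<close>

definition interlacing_seqs :: "nat \<Rightarrow> (nat \<Rightarrow> nat) \<Rightarrow> (nat \<Rightarrow> nat \<Rightarrow> nat) set" where
  "interlacing_seqs N lam =
     {l \<in> {0..N} \<rightarrow>\<^sub>E partitions. l 0 = empty_part \<and> l N = lam \<and> (\<forall>i<N. l i \<prec>\<prec> l (Suc i))}"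

definition seq_weight :: "(nat \<Rightarrow> real) \<Rightarrow> nat \<Rightarrow> (nat \<Rightarrow> nat \<Rightarrow> nat) \<Rightarrow> real" where
  "seq_weight c N l = (\<Prod>i=1..N. skew_schur1 (l i) (l (i - 1)) (c i))"

text \<open>The value $s_\lambda(c_1,\dots,c_N)$, by the branching rule; \<open>c 0\<close> is not used.\<close>

definition schur :: "(nat \<Rightarrow> real) \<Rightarrow> nat \<Rightarrow> (nat \<Rightarrow> nat) \<Rightarrow> real" where
  "schur c N lam = (\<Sum>l\<in>interlacing_seqs N lam. seq_weight c N l)"

lemma finite_interlacing_seqs: "finite (interlacing_seqs N lam)"
proof (cases "lam \<in> partitions")
  case True
  define B where "B = {kap. (\<forall>i. kap i \<le> lam i)}"
  have fs: "finite {i. lam i \<noteq> 0}"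
    using True by (simp add: partitions_def)
  have "B \<subseteq> {f. \<forall>i. (i \<in> {i. lam i \<noteq> 0} \<longrightarrow> f i \<in> {..lam 0}) \<and> (i \<notin> {i. lam i \<noteq> 0} \<longrightarrow> f i = 0)}"
  proof
    fix f assume f: "f \<in> B"
    have "f i \<le> lam 0" for i
    proof -
      have "lam i \<le> lam 0" using True by (auto simp: partitions_def antimono_def)
      moreover have "f i \<le> lam i" using f by (simp add: B_def)
      ultimately show ?thesis by simp
    qed
    moreover have "f i = 0" if "lam i = 0" for i
      using f that unfolding B_def by (metis (mono_tags, lifting) le_zero_eq mem_Collect_eq)
    ultimately show "f \<in> {f. \<forall>i. (i \<in> {i. lam i \<noteq> 0} \<longrightarrow> f i \<in> {..lam 0}) \<and> (i \<notin> {i. lam i \<noteq> 0} \<longrightarrow> f i = 0)}"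
      by simp
  qed
  hence finB: "finite B"
    by (rule finite_subset) (rule finite_set_of_finite_funs[OF fs], simp)
  have "interlacing_seqs N lam \<subseteq> {0..N} \<rightarrow>\<^sub>E B"
  proof
    fix l assume l: "l \<in> interlacing_seqs N lam"
    have le: "l i k \<le> lam k" if "i \<le> N" for i k
      using that
    proof (induction rule: inc_induct)
      case base
      then show ?case using l by (simp add: interlacing_seqs_def)
    next
      case (step n)
      have "l n \<prec>\<prec> l (Suc n)"
        using l step.hyps by (simp add: interlacing_seqs_def)
      then show ?case
        using step.IH by (meson interlace_def le_trans)
    qed
    show "l \<in> {0..N} \<rightarrow>\<^sub>E B"
      using l le by (auto simp: interlacing_seqs_def B_def PiE_iff)
  qed
  then show ?thesis
    by (rule finite_subset) (intro finite_PiE finB; simp)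
next
  case False
  have "interlacing_seqs N lam = {}"
    using False by (auto simp: interlacing_seqs_def PiE_iff)
  then show ?thesis by simp
qed

section \<open>Gibbs measures on interlacing arrays\<close>

definition arrays :: "(nat \<Rightarrow> nat \<Rightarrow> nat) set" where
  "arrays = {x. (\<forall>i. x i \<in> partitions) \<and> x 0 = empty_part \<and> (\<forall>i. x i \<prec>\<prec> x (Suc i))}"

text \<open>
  The set of arrays with the $\sigma$-algebra generated by its coordinates
  (the set of partitions is countable and carries the discrete $\sigma$-algebra).
\<close>

definition array_space :: "(nat \<Rightarrow> nat \<Rightarrow> nat) measure" where
  "array_space = restrict_space (PiM UNIV (\<lambda>_. count_space partitions)) arrays"

text \<open>
  The condition is imposed on those \<open>lam\<close> that occur with positive probability.
  Since some of the $c_i$ may vanish, the normalising constant may be 0; for the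
  prescribed ratio to be meaningful it has to be nonzero for each such \<open>lam\<close>.
\<close>

definition gibbs :: "(nat \<Rightarrow> real) \<Rightarrow> (nat \<Rightarrow> nat \<Rightarrow> nat) measure set" where
  "gibbs c = {M. prob_space M \<and> sets M = sets array_space \<and>
     (\<forall>N\<ge>1. \<forall>lam\<in>partitions. measure M {x \<in> space M. x N = lam} > 0 \<longrightarrow>
        schur c N lam \<noteq> 0 \<and>
        (\<forall>l. (\<forall>i\<le>N. l i \<in> partitions) \<and> l 0 = empty_part \<and> l N = lam \<longrightarrow>
           cond_prob M (\<lambda>x. \<forall>i\<in>{1..<N}. x i = l i) (\<lambda>x. x N = lam)
             = seq_weight c N l / schur c N lam))}"

section \<open>The Markov maps\<close>

text \<open>The truncated geometric distribution; only meaningful for \<open>0 \<le> \<alpha> \<le> 1\<close>.\<close>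

definition trunc_geom :: "real \<Rightarrow> nat \<Rightarrow> nat pmf" where
  "trunc_geom \<alpha> A =
     embed_pmf (\<lambda>k. if k < A then (1 - \<alpha>) * \<alpha> ^ k else if k = A then \<alpha> ^ A else 0)"

lemma pmf_trunc_geom:
  assumes "0 \<le> \<alpha>" "\<alpha> \<le> 1"
  shows "pmf (trunc_geom \<alpha> A) k =
    (if k < A then (1 - \<alpha>) * \<alpha> ^ k else if k = A then \<alpha> ^ A else 0)"
  unfolding trunc_geom_def
proof (rule pmf_embed_pmf)
  let ?f = "\<lambda>k. if k < A then (1 - \<alpha>) * \<alpha> ^ k else if k = A then \<alpha> ^ A else 0"
  show nn: "0 \<le> ?f k" for k using assms by auto
  have "(\<integral>\<^sup>+ k. ennreal (?f k) \<partial>count_space UNIV) = (\<Sum>k\<in>{..A}. ennreal (?f k))"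
    by (rule nn_integral_count_space'[of "{..A}"]) auto
  also have "\<dots> = ennreal (\<Sum>k\<in>{..A}. ?f k)"
    by (rule sum_ennreal) (rule nn)
  also have "(\<Sum>k\<in>{..A}. ?f k) = (\<Sum>k<A. ?f k) + ?f A"
    by (simp add: lessThan_Suc_atMost[symmetric] del: if_cong)
  also have "(\<Sum>k<A. ?f k) = (\<Sum>k<A. (1 - \<alpha>) * \<alpha> ^ k)"
    by (rule sum.cong) auto
  also have "\<dots> = 1 - \<alpha> ^ A"
    by (simp add: sum_distrib_left[symmetric] one_diff_power_eq)
  finally show "(\<integral>\<^sup>+ k. ennreal (?f k) \<partial>count_space UNIV) = 1" by simp
qed

text \<open>
  The lower and upper bounds for \<open>x j i\<close> in terms of its neighbours. At \<open>i = 0\<close> the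
  upper bound is $\min\{\infty, \lambda^{(j+1)}_1\}$. The convention
  $\lambda^{(i)}_{i+1} = 0$ holds automatically in \<open>arrays\<close>.
\<close>

definition lower_bd :: "nat \<Rightarrow> (nat \<Rightarrow> nat \<Rightarrow> nat) \<Rightarrow> nat \<Rightarrow> nat" where
  "lower_bd j x i = max (x (j - 1) i) (x (j + 1) (i + 1))"

definition upper_bd :: "nat \<Rightarrow> (nat \<Rightarrow> nat \<Rightarrow> nat) \<Rightarrow> nat \<Rightarrow> nat" where
  "upper_bd j x i = (if i = 0 then x (j + 1) 0 else min (x (j - 1) (i - 1)) (x (j + 1) i))"

text \<open>The law of the updated array, started from the array \<open>x\<close>.\<close>

definition L_pmf :: "nat \<Rightarrow> real \<Rightarrow> (nat \<Rightarrow> nat \<Rightarrow> nat) \<Rightarrow> (nat \<Rightarrow> nat \<Rightarrow> nat) pmf" where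
  "L_pmf j \<alpha> x =
     map_pmf (\<lambda>Y. x(j := (\<lambda>i. if i < j then lower_bd j x i + Y i else x j i)))
       (Pi_pmf {..<j} 0 (\<lambda>i. trunc_geom \<alpha> (x j i - lower_bd j x i)))"

definition R_pmf :: "nat \<Rightarrow> real \<Rightarrow> (nat \<Rightarrow> nat \<Rightarrow> nat) \<Rightarrow> (nat \<Rightarrow> nat \<Rightarrow> nat) pmf" where
  "R_pmf j \<alpha> x =
     map_pmf (\<lambda>Y. x(j := (\<lambda>i. if i < j then upper_bd j x i - Y i else x j i)))
       (Pi_pmf {..<j} 0 (\<lambda>i. trunc_geom \<alpha> (upper_bd j x i - x j i)))"

text \<open>A distribution supported on \<open>arrays\<close>, as a measure on \<open>array_space\<close>.\<close>

definition array_measure :: "(nat \<Rightarrow> nat \<Rightarrow> nat) pmf \<Rightarrow> (nat \<Rightarrow> nat \<Rightarrow> nat) measure" where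
  "array_measure p = distr (restrict_space (measure_pmf p) arrays) array_space (\<lambda>x. x)"

definition L_map :: "nat \<Rightarrow> real \<Rightarrow> (nat \<Rightarrow> nat \<Rightarrow> nat) measure \<Rightarrow> (nat \<Rightarrow> nat \<Rightarrow> nat) measure" where
  "L_map j \<alpha> M = M \<bind> (\<lambda>x. array_measure (L_pmf j \<alpha> x))"

definition R_map :: "nat \<Rightarrow> real \<Rightarrow> (nat \<Rightarrow> nat \<Rightarrow> nat) measure \<Rightarrow> (nat \<Rightarrow> nat \<Rightarrow> nat) measure" where
  "R_map j \<alpha> M = M \<bind> (\<lambda>x. array_measure (R_pmf j \<alpha> x))"

definition swap_params :: "nat \<Rightarrow> (nat \<Rightarrow> real) \<Rightarrow> nat \<Rightarrow> real" where
  "swap_params j c = c(j := c (j + 1), j + 1 := c j)"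

end

theory Submission
  imports Defs
begin

text \<open>
  Given its neighbouring rows $\mu = \lambda^{(j-1)}$ and $\nu = \lambda^{(j+1)}$, the row
  $\lambda^{(j)}$ ranges over a product of intervals $[a_k, b_k]$, and
  $s_{\varkappa/\mu}(p)\, s_{\nu/\varkappa}(q)$ factors as
  $(pq)^D \prod_k p^{\varkappa_k - a_k} q^{b_k - \varkappa_k}$ because
  $\sum_k (a_k + b_k) = |\mu| + |\nu|$. So it suffices that the update of a single coordinate
  sends the weights $p^{k-a} q^{b-k}$ to $q^{k-a} p^{b-k}$, which is a telescoping geometric sum.
  The Gibbs property says that the probability of each cylinder set is its weight times a
  function of the top row. In this form it passes from level $N+1$ to level $N$ by summation,
  so only the levels $N > j$ have to be checked, where the update swaps $c_j$ and $c_{j+1}$ in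
  the weight and keeps the top row.
\<close>

section \<open>Weights of a row between two fixed rows\<close>

text \<open>These are \<open>lower_bd\<close> and \<open>upper_bd\<close> as functions of the two
  neighbouring rows alone, so that the middle row can vary while the bounds stay fixed.\<close>

definition lo :: "(nat \<Rightarrow> nat) \<Rightarrow> (nat \<Rightarrow> nat) \<Rightarrow> nat \<Rightarrow> nat" where
  "lo mu nu i = max (mu i) (nu (i + 1))"

definition hi :: "(nat \<Rightarrow> nat) \<Rightarrow> (nat \<Rightarrow> nat) \<Rightarrow> nat \<Rightarrow> nat" where
  "hi mu nu i = (if i = 0 then nu 0 else min (mu (i - 1)) (nu i))"

definition rows_between :: "(nat \<Rightarrow> nat) \<Rightarrow> (nat \<Rightarrow> nat) \<Rightarrow> (nat \<Rightarrow> nat) set" where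
  "rows_between mu nu = {kap. mu \<prec>\<prec> kap \<and> kap \<prec>\<prec> nu}"

lemma psize_eq_sum:
  assumes "\<And>i. i \<ge> n \<Longrightarrow> lam i = 0"
  shows "psize lam = sum lam {..<n}"
  unfolding psize_def
proof (rule sum.mono_neutral_left)
  show "{i. lam i \<noteq> 0} \<subseteq> {..<n}"
  proof
    fix i assume "i \<in> {i. lam i \<noteq> 0}"
    thus "i \<in> {..<n}" using assms[of i] by (cases "i < n") auto
  qed
qed auto

text \<open>The distributive law \<open>prod_sum_PiE\<close>, transported along restriction to
  \<open>A\<close>; this is injective because functions in \<open>PiE_dflt\<close> have the forced
  value \<open>d\<close> outside \<open>A\<close>.\<close>

lemma sum_PiE_dflt_prod:
  fixes f :: "'a \<Rightarrow> 'b \<Rightarrow> 'c :: comm_semiring_1"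
  assumes "finite A" "\<And>x. x \<in> A \<Longrightarrow> finite (B x)"
  shows "(\<Sum>g\<in>PiE_dflt A d B. \<Prod>x\<in>A. f x (g x)) = (\<Prod>x\<in>A. \<Sum>y\<in>B x. f x y)"
proof -
  have inj: "inj_on (\<lambda>h. restrict h A) (PiE_dflt A d B)"
  proof (rule inj_onI)
    fix g h assume gh: "g \<in> PiE_dflt A d B" "h \<in> PiE_dflt A d B" "restrict g A = restrict h A"
    show "g = h"
    proof
      fix x show "g x = h x"
        using gh(1,2) fun_cong[OF gh(3), of x] by (cases "x \<in> A") (auto simp: PiE_dflt_def)
    qed
  qed
  have "(\<Prod>x\<in>A. \<Sum>y\<in>B x. f x y) = (\<Sum>g\<in>PiE A B. \<Prod>x\<in>A. f x (g x))"
    by (rule prod_sum_PiE) (use assms in auto)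
  also have "\<dots> = (\<Sum>g\<in>PiE_dflt A d B. \<Prod>x\<in>A. f x (restrict g A x))"
    unfolding restrict_PiE_dflt[of A d B, symmetric] by (simp add: sum.reindex[OF inj])
  finally show ?thesis by simp
qed

text \<open>The kernel \<open>T\<close> gets the two ends of the interval and the old value. It is a
  parameter so that one argument covers both Markov maps; the default 0 is the value of the parts
  from index \<open>j\<close> on.\<close>

definition row_law ::
  "(nat \<Rightarrow> nat \<Rightarrow> nat \<Rightarrow> nat pmf) \<Rightarrow> nat \<Rightarrow> (nat \<Rightarrow> nat) \<Rightarrow> (nat \<Rightarrow> nat) \<Rightarrow> (nat \<Rightarrow> nat) \<Rightarrow> (nat \<Rightarrow> nat) pmf" where
  "row_law T j mu kap nu = Pi_pmf {..<j} 0 (\<lambda>i. T (lo mu nu i) (hi mu nu i) (kap i))"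

context
  fixes j :: nat and mu nu :: "nat \<Rightarrow> nat"
  assumes j: "j \<ge> 1" and mu0: "\<forall>i\<ge>j - 1. mu i = 0" and nu0: "\<forall>i>j. nu i = 0"
begin

text \<open>Interlacing with two fixed neighbours constrains each part separately, and the zeros of
  the neighbours leave only the parts below \<open>j\<close> free.\<close>

lemma rows_between_eq_PiE_dflt:
  "rows_between mu nu = PiE_dflt {..<j} 0 (\<lambda>i. {lo mu nu i..hi mu nu i})"
proof (intro equalityI subsetI)
  fix kap assume k: "kap \<in> rows_between mu nu"
  have "lo mu nu i \<le> kap i" for i
    using k by (simp add: rows_between_def interlace_def lo_def)
  moreover have up: "kap i \<le> hi mu nu i" for i
    using k by (cases i) (auto simp: rows_between_def interlace_def hi_def)
  \<comment> \<open>As \<open>j \<ge> 1\<close>, the index is positive, so \<open>hi\<close> is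
    bounded by \<open>mu (i - 1)\<close>, which is 0.\<close>
  moreover have "kap i = 0" if "i \<ge> j" for i
    using up[of i] that j mu0 by (auto simp: hi_def)
  ultimately show "kap \<in> PiE_dflt {..<j} 0 (\<lambda>i. {lo mu nu i..hi mu nu i})"
    by (auto simp: PiE_dflt_def)
next
  fix kap assume "kap \<in> PiE_dflt {..<j} 0 (\<lambda>i. {lo mu nu i..hi mu nu i})"
  hence k: "\<And>i. i < j \<Longrightarrow> lo mu nu i \<le> kap i" "\<And>i. i < j \<Longrightarrow> kap i \<le> hi mu nu i"
    "\<And>i. i \<ge> j \<Longrightarrow> kap i = 0"
    by (auto simp: PiE_dflt_def)
  have "mu i \<le> kap i \<and> nu (Suc i) \<le> kap i" for i
    using k(1)[of i] k(3)[of i] mu0 nu0 by (cases "i < j") (auto simp: lo_def)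
  moreover have "kap i \<le> nu i" for i
    using k(2)[of i] k(3)[of i] by (cases "i < j") (auto simp: hi_def split: if_splits)
  moreover have "kap (Suc i) \<le> mu i" for i
    using k(2)[of "Suc i"] k(3)[of "Suc i"] by (cases "Suc i < j") (auto simp: hi_def)
  ultimately show "kap \<in> rows_between mu nu"
    by (simp add: rows_between_def interlace_def)
qed

text \<open>
  The bounds pair up as \<open>lo i + hi (i + 1) = mu i + nu (i + 1)\<close>. This makes the
  exponents left over in \<open>skew_schur1_product\<close> equal, hence symmetric in the two parameters.
\<close>

lemma sum_lo_hi:
  "(\<Sum>i<j. lo mu nu i) + (\<Sum>i<j. hi mu nu i) = psize mu + psize nu"
proof -
  obtain m where m: "j = Suc m" using j by (cases j) auto
  have pm: "psize mu = (\<Sum>i<m. mu i)"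
    by (rule psize_eq_sum) (use m mu0 in auto)
  have "psize nu = (\<Sum>i<Suc (Suc m). nu i)"
    by (rule psize_eq_sum) (use nu0 m in auto)
  also have "\<dots> = nu 0 + (\<Sum>i<m. nu (Suc i)) + nu (Suc m)"
    by (subst sum.lessThan_Suc_shift) simp
  finally have pn: "psize nu = nu 0 + (\<Sum>i<m. nu (Suc i)) + nu (Suc m)" .
  \<comment> \<open>Left unpaired are \<open>hi\<close> at 0, which is \<open>nu 0\<close>, and
    \<open>lo\<close> at \<open>m = j - 1\<close>, which is \<open>nu (Suc m)\<close> because
    \<open>mu m = 0\<close>.\<close>
  have "(\<Sum>i<j. hi mu nu i) = nu 0 + (\<Sum>i<m. hi mu nu (Suc i))"
    unfolding m by (subst sum.lessThan_Suc_shift) (simp add: hi_def)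
  moreover have "(\<Sum>i<j. lo mu nu i) = (\<Sum>i<m. lo mu nu i) + nu (Suc m)"
    using mu0 by (simp add: m lo_def)
  moreover have "(\<Sum>i<m. lo mu nu i) + (\<Sum>i<m. hi mu nu (Suc i)) = (\<Sum>i<m. mu i) + (\<Sum>i<m. nu (Suc i))"
    unfolding sum.distrib[symmetric]
    by (rule sum.cong) (auto simp: lo_def hi_def)
  ultimately show ?thesis using pm pn by simp
qed

text \<open>The exponents \<open>psize kap - psize mu\<close> and
  \<open>psize nu - psize kap\<close> are sums over coordinates up to additive constants, and
  \<open>sum_lo_hi\<close> identifies both constants with the same \<open>D\<close>.\<close>

lemma skew_schur1_product:
  fixes p q :: real
  assumes k: "kap \<in> rows_between mu nu"
  shows "skew_schur1 kap mu p * skew_schur1 nu kap q =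
    (p * q) ^ ((\<Sum>i<j. lo mu nu i) - psize mu) *
      (\<Prod>i<j. p ^ (kap i - lo mu nu i) * q ^ (hi mu nu i - kap i))"
proof -
  define D where "D = (\<Sum>i<j. lo mu nu i) - psize mu"
  have k': "kap \<in> PiE_dflt {..<j} 0 (\<lambda>i. {lo mu nu i..hi mu nu i})"
    using k rows_between_eq_PiE_dflt by simp
  have pk: "psize kap = (\<Sum>i<j. kap i)"
    by (rule psize_eq_sum) (use k' in \<open>auto simp: PiE_dflt_def\<close>)
  \<comment> \<open>As \<open>mu \<le> lo\<close> pointwise, the natural subtraction in
    \<open>D\<close> does not truncate.\<close>
  have "psize mu = (\<Sum>i<j. mu i)"
    by (rule psize_eq_sum) (use mu0 in auto)
  also have "\<dots> \<le> (\<Sum>i<j. lo mu nu i)"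
    by (rule sum_mono) (simp add: lo_def)
  finally have D: "(\<Sum>i<j. lo mu nu i) = D + psize mu"
    by (simp add: D_def)
  have "(\<Sum>i<j. lo mu nu i) + (\<Sum>i<j. kap i - lo mu nu i) = (\<Sum>i<j. kap i)"
    unfolding sum.distrib[symmetric]
    by (rule sum.cong) (use k' in \<open>auto simp: PiE_dflt_def\<close>)
  hence e1: "psize kap - psize mu = D + (\<Sum>i<j. kap i - lo mu nu i)"
    using D pk by linarith
  have "(\<Sum>i<j. kap i) + (\<Sum>i<j. hi mu nu i - kap i) = (\<Sum>i<j. hi mu nu i)"
    unfolding sum.distrib[symmetric]
    by (rule sum.cong) (use k' in \<open>auto simp: PiE_dflt_def\<close>)
  hence e2: "psize nu - psize kap = D + (\<Sum>i<j. hi mu nu i - kap i)"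
    using D pk sum_lo_hi by linarith
  show ?thesis
    using k unfolding D_def[symmetric]
    by (simp add: skew_schur1_def rows_between_def e1 e2 power_add power_sum prod.distrib
          power_mult_distrib)
qed

lemma finite_rows_between: "finite (rows_between mu nu)"
  by (subst rows_between_eq_PiE_dflt) auto

text \<open>Weights and transition probabilities both factor over the coordinates, so the sum over
  \<open>kap\<close> becomes a product of sums over single intervals, each given by the first
  hypothesis. The prefactor is symmetric in \<open>p\<close> and \<open>q\<close>.\<close>

lemma row_law_swap:
  fixes p q :: real
  assumes T: "\<And>a b y. a \<le> y \<Longrightarrow> y \<le> b \<Longrightarrow>
      (\<Sum>k=a..b. p ^ (k - a) * q ^ (b - k) * pmf (T a b k) y) = q ^ (y - a) * p ^ (b - y)"
    and k': "kap' \<in> rows_between mu nu"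
  shows "(\<Sum>kap\<in>rows_between mu nu.
      skew_schur1 kap mu p * skew_schur1 nu kap q * pmf (row_law T j mu kap nu) kap') =
    skew_schur1 kap' mu q * skew_schur1 nu kap' p"
proof -
  define D where "D = (\<Sum>i<j. lo mu nu i) - psize mu"
  note R = rows_between_eq_PiE_dflt
  have k'': "kap' \<in> PiE_dflt {..<j} 0 (\<lambda>i. {lo mu nu i..hi mu nu i})"
    using k' R by simp
  let ?f = "\<lambda>i k. p ^ (k - lo mu nu i) * q ^ (hi mu nu i - k) *
      pmf (T (lo mu nu i) (hi mu nu i) k) (kap' i)"
  have "(\<Sum>kap\<in>rows_between mu nu.
      skew_schur1 kap mu p * skew_schur1 nu kap q * pmf (row_law T j mu kap nu) kap') =
    (\<Sum>kap\<in>rows_between mu nu. (p * q) ^ D * (\<Prod>i<j. ?f i (kap i)))"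
  proof (rule sum.cong)
    fix kap assume k: "kap \<in> rows_between mu nu"
    have "pmf (row_law T j mu kap nu) kap' = (\<Prod>i<j. pmf (T (lo mu nu i) (hi mu nu i) (kap i)) (kap' i))"
      unfolding row_law_def by (rule pmf_Pi') (use k'' in \<open>auto simp: PiE_dflt_def\<close>)
    thus "skew_schur1 kap mu p * skew_schur1 nu kap q * pmf (row_law T j mu kap nu) kap' =
      (p * q) ^ D * (\<Prod>i<j. ?f i (kap i))"
      by (simp add: skew_schur1_product[OF k] D_def prod.distrib)
  qed simp
  also have "\<dots> = (p * q) ^ D * (\<Prod>i<j. \<Sum>k=lo mu nu i..hi mu nu i. ?f i k)"
    unfolding sum_distrib_left[symmetric] R by (subst sum_PiE_dflt_prod) auto
  also have "(\<Prod>i<j. \<Sum>k=lo mu nu i..hi mu nu i. ?f i k) =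
      (\<Prod>i<j. q ^ (kap' i - lo mu nu i) * p ^ (hi mu nu i - kap' i))"
    by (rule prod.cong[OF refl], rule T) (use k'' in \<open>auto simp: PiE_dflt_def\<close>)
  also have "(p * q) ^ D * \<dots> = skew_schur1 kap' mu q * skew_schur1 nu kap' p"
    by (simp add: skew_schur1_product[OF k'] D_def mult.commute)
  finally show ?thesis .
qed

end

section \<open>Updating a single coordinate\<close>

definition L_step :: "real \<Rightarrow> nat \<Rightarrow> nat \<Rightarrow> nat \<Rightarrow> nat pmf" where
  "L_step \<alpha> a b k = map_pmf (\<lambda>y. a + y) (trunc_geom \<alpha> (k - a))"

definition R_step :: "real \<Rightarrow> nat \<Rightarrow> nat \<Rightarrow> nat \<Rightarrow> nat pmf" where
  "R_step \<alpha> a b k = map_pmf (\<lambda>y. b - y) (trunc_geom \<alpha> (b - k))"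

lemma set_trunc_geom: "0 \<le> \<alpha> \<Longrightarrow> \<alpha> \<le> 1 \<Longrightarrow> set_pmf (trunc_geom \<alpha> A) \<subseteq> {..A}"
  by (auto simp: set_pmf_eq pmf_trunc_geom split: if_splits)

lemma set_L_step:
  "0 \<le> \<alpha> \<Longrightarrow> \<alpha> \<le> 1 \<Longrightarrow> a \<le> k \<Longrightarrow> k \<le> b \<Longrightarrow> set_pmf (L_step \<alpha> a b k) \<subseteq> {a..b}"
  using set_trunc_geom[of \<alpha> "k - a"] by (force simp: L_step_def)

lemma set_R_step:
  "0 \<le> \<alpha> \<Longrightarrow> \<alpha> \<le> 1 \<Longrightarrow> a \<le> k \<Longrightarrow> k \<le> b \<Longrightarrow> set_pmf (R_step \<alpha> a b k) \<subseteq> {a..b}"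
  using set_trunc_geom[of \<alpha> "b - k"] by (force simp: R_step_def)

lemma pmf_L_step:
  assumes "0 \<le> \<alpha>" "\<alpha> \<le> 1" "a \<le> y"
  shows "pmf (L_step \<alpha> a b k) y = pmf (trunc_geom \<alpha> (k - a)) (y - a)"
  using assms pmf_map_inj'[of "\<lambda>y. a + y" "trunc_geom \<alpha> (k - a)" "y - a"]
  by (simp add: L_step_def)

text \<open>Unlike adding \<open>a\<close>, truncated subtraction from \<open>b\<close> is injective
  only on values up to \<open>b\<close>; the support bound of the truncated geometric law confines
  it to those.\<close>

lemma pmf_R_step:
  assumes "0 \<le> \<alpha>" "\<alpha> \<le> 1" "y \<le> b"
  shows "pmf (R_step \<alpha> a b k) y = pmf (trunc_geom \<alpha> (b - k)) (b - y)"
proof -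
  have *: "set_pmf (trunc_geom \<alpha> (b - k)) \<subseteq> {..b - k}"
    by (rule set_trunc_geom) fact+
  show ?thesis
  proof (cases "b - y \<in> set_pmf (trunc_geom \<alpha> (b - k))")
    case True
    have "inj_on (\<lambda>y. b - y) (set_pmf (trunc_geom \<alpha> (b - k)))"
      by (rule inj_on_subset[OF _ *]) (auto simp: inj_on_def)
    from pmf_map_inj[OF this True] show ?thesis using assms by (simp add: R_step_def)
  next
    case False
    hence "y \<notin> set_pmf (R_step \<alpha> a b k)"
      using * assms by (force simp: R_step_def)
    with False show ?thesis by (simp add: set_pmf_iff)
  qed
qed

text \<open>Truncation makes the sum over the starting points telescope.\<close>

lemma trunc_geom_swap:
  fixes p q :: real
  assumes "0 \<le> q" "q \<le> p" "p \<noteq> 0" "y \<le> m"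
  shows "(\<Sum>k\<le>m. p ^ k * q ^ (m - k) * pmf (trunc_geom (q / p) k) y) = q ^ y * p ^ (m - y)"
proof -
  have \<alpha>: "0 \<le> q / p" "q / p \<le> 1" using assms by (auto simp: field_simps)
  \<comment> \<open>For starting points \<open>k > y\<close> the probability of \<open>y\<close> is
    the untruncated \<open>(1 - q/p) (q/p)^y\<close>, and the factor \<open>1 - q/p\<close> turns
    the weight at \<open>k\<close> into a difference of consecutive weights.\<close>
  have tail: "(\<Sum>k\<in>{y<..m}. p ^ k * q ^ (m - k) * pmf (trunc_geom (q / p) k) y) =
      (q / p) ^ y * (p ^ m - p ^ y * q ^ (m - y))" (is "?S = _")
  proof -
    have "?S = (\<Sum>k\<in>{Suc y..m}. (q / p) ^ y * (p ^ k * q ^ (m - k) - p ^ (k - 1) * q ^ (m - (k - 1))))"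
    proof (rule sum.cong)
      fix k assume k: "k \<in> {Suc y..m}"
      then obtain n where n: "k = Suc n" by (cases k) auto
      have "m - n = Suc (m - k)" using k n by auto
      with k n assms(3) \<alpha> show "p ^ k * q ^ (m - k) * pmf (trunc_geom (q / p) k) y =
          (q / p) ^ y * (p ^ k * q ^ (m - k) - p ^ (k - 1) * q ^ (m - (k - 1)))"
        by (simp add: pmf_trunc_geom field_simps)
    qed auto
    also have "\<dots> = (q / p) ^ y * (\<Sum>k\<in>{Suc y..m}. p ^ k * q ^ (m - k) - p ^ (k - 1) * q ^ (m - (k - 1)))"
      by (simp add: sum_distrib_left)
    also have "(\<Sum>k\<in>{Suc y..m}. p ^ k * q ^ (m - k) - p ^ (k - 1) * q ^ (m - (k - 1))) =
        p ^ m - p ^ y * q ^ (m - y)"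
      using sum_telescope''[of y m "\<lambda>k. p ^ k * q ^ (m - k)"] assms(4) by simp
    finally show ?thesis .
  qed
  \<comment> \<open>Starting points \<open>k < y\<close> never reach \<open>y\<close>. The point
    \<open>k = y\<close> carries the atom \<open>(q/p)^y\<close>, whose contribution cancels the
    lower end of the telescoped tail.\<close>
  have "(\<Sum>k\<le>m. p ^ k * q ^ (m - k) * pmf (trunc_geom (q / p) k) y) =
      (\<Sum>k\<in>insert y {y<..m}. p ^ k * q ^ (m - k) * pmf (trunc_geom (q / p) k) y)"
    by (rule sum.mono_neutral_right) (use assms(4) \<alpha> in \<open>auto simp: pmf_trunc_geom\<close>)
  also have "\<dots> = p ^ y * q ^ (m - y) * (q / p) ^ y + (q / p) ^ y * (p ^ m - p ^ y * q ^ (m - y))"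
    unfolding tail[symmetric] using \<alpha> by (simp add: pmf_trunc_geom)
  also have "\<dots> = (q / p) ^ y * p ^ m"
    by (simp add: right_diff_distrib mult_ac)
  also have "\<dots> = q ^ y * p ^ (m - y)"
    using assms by (simp add: power_divide power_diff)
  finally show ?thesis .
qed

lemma L_step_swap:
  fixes p q :: real
  assumes "0 \<le> q" "q \<le> p" "p \<noteq> 0" "a \<le> y" "y \<le> b"
  shows "(\<Sum>k=a..b. p ^ (k - a) * q ^ (b - k) * pmf (L_step (q / p) a b k) y) = q ^ (y - a) * p ^ (b - y)"
proof -
  have \<alpha>: "0 \<le> q / p" "q / p \<le> 1" using assms by (auto simp: field_simps)
  have "(\<Sum>k=a..b. p ^ (k - a) * q ^ (b - k) * pmf (L_step (q / p) a b k) y) =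
      (\<Sum>k\<le>b - a. p ^ k * q ^ (b - a - k) * pmf (trunc_geom (q / p) k) (y - a))"
    by (rule sum.reindex_bij_witness[of _ "\<lambda>k. k + a" "\<lambda>k. k - a"])
       (use assms \<alpha> in \<open>auto simp: pmf_L_step\<close>)
  also have "\<dots> = q ^ (y - a) * p ^ (b - a - (y - a))"
    by (rule trunc_geom_swap) (use assms in auto)
  finally show ?thesis using assms by simp
qed

text \<open>The reflection sending \<open>k\<close> to \<open>b - k\<close> exchanges the roles of
  \<open>p\<close> and \<open>q\<close> and reduces the claim to
  \<open>trunc_geom_swap\<close>.\<close>

lemma R_step_swap:
  fixes p q :: real
  assumes "0 \<le> p" "p \<le> q" "q \<noteq> 0" "a \<le> y" "y \<le> b"
  shows "(\<Sum>k=a..b. p ^ (k - a) * q ^ (b - k) * pmf (R_step (p / q) a b k) y) = q ^ (y - a) * p ^ (b - y)"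
proof -
  have \<alpha>: "0 \<le> p / q" "p / q \<le> 1" using assms by (auto simp: field_simps)
  have "(\<Sum>k=a..b. p ^ (k - a) * q ^ (b - k) * pmf (R_step (p / q) a b k) y) =
      (\<Sum>k\<le>b - a. q ^ k * p ^ (b - a - k) * pmf (trunc_geom (p / q) k) (b - y))"
    by (rule sum.reindex_bij_witness[of _ "\<lambda>k. b - k" "\<lambda>k. b - k"])
       (use assms \<alpha> in \<open>auto simp: pmf_R_step\<close>)
  also have "\<dots> = p ^ (b - y) * q ^ (b - a - (b - y))"
    by (rule trunc_geom_swap) (use assms in auto)
  finally show ?thesis using assms by simp
qed

section \<open>The Markov maps as row updates with independent coordinates\<close>

lemma map_Pi_pmf_dependent:
  assumes A: "finite A"
  shows "map_pmf (\<lambda>h x. if x \<in> A then f x (h x) else d') (Pi_pmf A d g) =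
    Pi_pmf A d' (\<lambda>x. map_pmf (f x) (g x))"
proof -
  have "Pi_pmf A d' (\<lambda>x. map_pmf (f x) (g x)) =
      bind_pmf (Pi_pmf A d g) (\<lambda>h. Pi_pmf A d' (\<lambda>x. return_pmf (f x (h x))))"
    unfolding map_pmf_def by (rule Pi_pmf_bind[OF A])
  thus ?thesis using A by (simp add: map_pmf_def)
qed

text \<open>An interlacing step allows at most one further nonzero part, and row 0 is empty.\<close>

lemma arrays_eq_0:
  assumes "x \<in> arrays" "i \<ge> k"
  shows "x k i = 0"
  using assms(2)
proof (induction k arbitrary: i)
  case 0
  then show ?case using assms(1) by (simp add: arrays_def)
next
  case (Suc k)
  then obtain n where "i = Suc n" "n \<ge> k" by (cases i) auto
  moreover have "x (Suc k) (Suc n) \<le> x k n"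
    using assms(1) by (simp add: arrays_def interlace_def)
  ultimately show ?case using Suc.IH[of n] by simp
qed

lemma L_pmf_eq:
  assumes "x \<in> arrays"
  shows "L_pmf j \<alpha> x =
    map_pmf (\<lambda>kap. x(j := kap)) (row_law (L_step \<alpha>) j (x (j - 1)) (x j) (x (j + 1)))"
proof -
  have "row_law (L_step \<alpha>) j (x (j - 1)) (x j) (x (j + 1)) =
     map_pmf (\<lambda>h i. if i \<in> {..<j} then lower_bd j x i + h i else 0)
       (Pi_pmf {..<j} 0 (\<lambda>i. trunc_geom \<alpha> (x j i - lower_bd j x i)))"
    by (subst map_Pi_pmf_dependent) (simp_all add: row_law_def L_step_def lo_def lower_bd_def)
  \<comment> \<open>From index \<open>j\<close> on, row \<open>j\<close> of an array is 0, so
    leaving these parts unchanged agrees with the default of the product law.\<close>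
  moreover have "(\<lambda>i. if i < j then a i else x j i) = (\<lambda>i. if i < j then a i else 0)" for a
    using arrays_eq_0[OF assms] by auto
  ultimately show ?thesis
    by (simp add: L_pmf_def pmf.map_comp o_def)
qed

lemma R_pmf_eq:
  assumes "x \<in> arrays"
  shows "R_pmf j \<alpha> x =
    map_pmf (\<lambda>kap. x(j := kap)) (row_law (R_step \<alpha>) j (x (j - 1)) (x j) (x (j + 1)))"
proof -
  have "row_law (R_step \<alpha>) j (x (j - 1)) (x j) (x (j + 1)) =
     map_pmf (\<lambda>h i. if i \<in> {..<j} then upper_bd j x i - h i else 0)
       (Pi_pmf {..<j} 0 (\<lambda>i. trunc_geom \<alpha> (upper_bd j x i - x j i)))"
    by (subst map_Pi_pmf_dependent)
       (simp_all add: row_law_def R_step_def hi_def upper_bd_def cong: if_cong)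
  moreover have "(\<lambda>i. if i < j then a i else x j i) = (\<lambda>i. if i < j then a i else 0)" for a
    using arrays_eq_0[OF assms] by auto
  ultimately show ?thesis
    by (simp add: R_pmf_def pmf.map_comp o_def)
qed

section \<open>The space of arrays and its cylinder sets\<close>

lemma countable_partitions: "countable partitions"
proof -
  have "partitions \<subseteq> range (\<lambda>xs i. if i < length xs then xs ! i else (0::nat))"
  proof
    fix lam :: "nat \<Rightarrow> nat" assume "lam \<in> partitions"
    then obtain n where n: "\<And>i. lam i \<noteq> 0 \<Longrightarrow> i < n"
      by (auto simp: partitions_def finite_nat_set_iff_bounded)
    have "lam = (\<lambda>i. if i < length (map lam [0..<n]) then map lam [0..<n] ! i else 0)"
      using n by (auto simp: fun_eq_iff)
    thus "lam \<in> range (\<lambda>xs i. if i < length xs then xs ! i else 0)" by blast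
  qed
  thus ?thesis by (rule countable_subset) auto
qed

lemma arrays_in_sets_PiM: "arrays \<in> sets (PiM UNIV (\<lambda>_. count_space partitions))"
proof -
  let ?P = "PiM UNIV (\<lambda>_::nat. count_space partitions)"
  have [measurable]: "(\<lambda>x. x i) \<in> measurable ?P (count_space partitions)" for i
    by (rule measurable_component_singleton) simp
  have [measurable]: "Measurable.pred ?P (\<lambda>x. Q (x i))" for Q i
    by (rule measurable_compose[where N="count_space partitions"]) auto
  \<comment> \<open>The relation is decomposed over the countably many values of row
    \<open>i\<close>; for each value it is a condition on one coordinate.\<close>
  have [measurable]: "Measurable.pred ?P (\<lambda>x. x i \<prec>\<prec> x (Suc i))" for i
    by (rule measurable_compose_countable'[where g="\<lambda>x. x i" and I=partitions])
       (auto intro: countable_partitions)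
  have "arrays = {x \<in> space ?P. x 0 = empty_part \<and> (\<forall>i. x i \<prec>\<prec> x (Suc i))}"
    by (auto simp: arrays_def space_PiM)
  also have "\<dots> \<in> sets ?P" by measurable
  finally show ?thesis .
qed

lemma space_array_space: "space array_space = arrays"
  using sets.sets_into_space[OF arrays_in_sets_PiM]
  by (auto simp: array_space_def space_restrict_space)

lemma sets_array_space_iff:
  "A \<in> sets array_space \<longleftrightarrow> A \<subseteq> arrays \<and> A \<in> sets (PiM UNIV (\<lambda>_. count_space partitions))"
  unfolding array_space_def using arrays_in_sets_PiM sets.sets_into_space[OF arrays_in_sets_PiM]
  by (subst sets_restrict_space_iff) (auto simp: Int_absorb2)

lemma measurable_row: "(\<lambda>x. x i) \<in> measurable array_space (count_space partitions)"
  unfolding array_space_def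
  by (rule measurable_restrict_space1) (rule measurable_component_singleton, simp)

definition cylinder :: "nat \<Rightarrow> (nat \<Rightarrow> nat \<Rightarrow> nat) \<Rightarrow> (nat \<Rightarrow> nat \<Rightarrow> nat) set" where
  "cylinder N l = {x \<in> arrays. \<forall>i\<le>N. x i = l i}"

lemma sets_row_eq: "{x \<in> arrays. x i = lam} \<in> sets array_space"
proof -
  \<comment> \<open>Intersecting with \<open>partitions\<close> also covers a \<open>lam\<close>
    that is no partition, for which the set is empty.\<close>
  have "(\<lambda>x. x i) -` ({lam} \<inter> partitions) \<inter> space array_space \<in> sets array_space"
    by (rule measurable_sets[OF measurable_row]) simp
  also have "(\<lambda>x. x i) -` ({lam} \<inter> partitions) \<inter> space array_space = {x \<in> arrays. x i = lam}"
    by (auto simp: space_array_space arrays_def)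
  finally show ?thesis .
qed

lemma sets_cylinder: "cylinder N l \<in> sets array_space"
proof -
  have "cylinder N l = (\<Inter>i\<in>{..N}. {x \<in> arrays. x i = l i})"
    by (auto simp: cylinder_def)
  also have "\<dots> \<in> sets array_space"
    by (rule sets.finite_INT) (auto simp: sets_row_eq)
  finally show ?thesis .
qed

section \<open>The Gibbs property on cylinder sets\<close>

lemma seq_weight_nonneg:
  assumes "\<forall>i\<ge>1. c i \<ge> 0"
  shows "seq_weight c N l \<ge> 0"
  unfolding seq_weight_def using assms by (intro prod_nonneg) (auto simp: skew_schur1_def)

lemma schur_nonneg:
  assumes "\<forall>i\<ge>1. c i \<ge> 0"
  shows "schur c N l \<ge> 0"
  unfolding schur_def by (intro sum_nonneg seq_weight_nonneg assms)

lemma seq_weight_not_interlacing: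
  assumes "i < N" "\<not> l i \<prec>\<prec> l (Suc i)"
  shows "seq_weight c N l = 0"
  unfolding seq_weight_def using assms
  by (intro prod_zero) (auto intro!: bexI[of _ "Suc i"] simp: skew_schur1_def)

lemma seq_weight_cong: "(\<And>i. i \<le> N \<Longrightarrow> l i = l' i) \<Longrightarrow> seq_weight c N l = seq_weight c N l'"
  unfolding seq_weight_def by (intro prod.cong) auto

text \<open>
  Equivalent form of the Gibbs property at level \<open>N\<close> without quotients. The factor \<open>h\<close> may
  take the value \<open>\<infinity>\<close> where all weights vanish, as \<open>\<infinity> * 0 = 0\<close> in \<open>ennreal\<close>.
\<close>

definition gibbs_level :: "(nat \<Rightarrow> real) \<Rightarrow> nat \<Rightarrow> (nat \<Rightarrow> nat \<Rightarrow> nat) measure \<Rightarrow> bool" where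
  "gibbs_level c N M \<longleftrightarrow> (\<exists>h. \<forall>l. (\<forall>i\<le>N. l i \<in> partitions) \<and> l 0 = empty_part \<longrightarrow>
     emeasure M (cylinder N l) = h (l N) * ennreal (seq_weight c N l))"

text \<open>The set on the right is the joint event in the conditional probability of
  \<open>gibbs\<close>; it leaves out row 0, which is empty in every array.\<close>

lemma cylinder_eq:
  assumes "N \<ge> 1" "l 0 = empty_part"
  shows "cylinder N l = {x \<in> arrays. (\<forall>i\<in>{1..<N}. x i = l i) \<and> x N = l N}"
  unfolding cylinder_def
proof (intro Collect_cong conj_cong refl iffI allI impI)
  fix x i assume x: "x \<in> arrays" "(\<forall>i\<in>{1..<N}. x i = l i) \<and> x N = l N" and i: "i \<le> N"
  show "x i = l i"
    using x i assms by (cases "i = 0"; cases "i = N") (auto simp: arrays_def)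
qed (use assms in auto)

text \<open>The factor is the probability of the top row divided by its Schur value. On a top row of
  probability 0 both sides vanish, whatever the Schur value is.\<close>

lemma gibbs_imp_gibbs_level:
  assumes c: "\<forall>i\<ge>1. c i \<ge> 0" and M: "M \<in> gibbs c" and N: "N \<ge> 1"
  shows "gibbs_level c N M"
proof -
  from M interpret prob_space M by (simp add: gibbs_def)
  have sM: "sets M = sets array_space" using M by (simp add: gibbs_def)
  hence spM: "space M = arrays" using sets_eq_imp_space_eq space_array_space by metis
  define m where "m lam = measure M {x \<in> arrays. x N = lam}" for lam
  have "emeasure M (cylinder N l) = ennreal (m (l N) / schur c N (l N)) * ennreal (seq_weight c N l)"
    if l: "\<forall>i\<le>N. l i \<in> partitions" "l 0 = empty_part" for l
  proof -
    note cyl = cylinder_eq[of N l, OF N l(2)]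
    have "measure M (cylinder N l) = m (l N) / schur c N (l N) * seq_weight c N l"
    proof (cases "m (l N) > 0")
      case True
      have "cond_prob M (\<lambda>x. \<forall>i\<in>{1..<N}. x i = l i) (\<lambda>x. x N = l N) = seq_weight c N l / schur c N (l N)"
        using M N l True by (auto simp: gibbs_def m_def spM)
      thus ?thesis using True
        by (simp add: cond_prob_def spM cyl m_def[symmetric] field_simps)
    next
      case False
      hence m0: "m (l N) = 0" by (simp add: m_def zero_less_measure_iff)
      have "measure M (cylinder N l) \<le> m (l N)"
        unfolding m_def by (rule finite_measure_mono) (auto simp: cylinder_def sM sets_row_eq)
      with m0 show ?thesis by (simp add: measure_le_0_iff)
    qed
    thus ?thesis using seq_weight_nonneg[OF c, of N l]
      by (simp add: emeasure_eq_measure ennreal_mult''[symmetric])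
  qed
  thus ?thesis unfolding gibbs_level_def by (intro exI[of _ "\<lambda>lam. ennreal (m lam / schur c N lam)"]) auto
qed

lemma row_eq_UN_cylinder:
  assumes "lam \<in> partitions"
  shows "{x \<in> arrays. x N = lam} = (\<Union>l\<in>interlacing_seqs N lam. cylinder N l)"
proof (intro equalityI subsetI)
  fix x assume "x \<in> {x \<in> arrays. x N = lam}"
  hence "restrict x {0..N} \<in> interlacing_seqs N lam" "x \<in> cylinder N (restrict x {0..N})"
    by (auto simp: interlacing_seqs_def cylinder_def arrays_def)
  thus "x \<in> (\<Union>l\<in>interlacing_seqs N lam. cylinder N l)" by blast
qed (auto simp: interlacing_seqs_def cylinder_def)

text \<open>Sequences are extensional on \<open>{0..N}\<close>, so different ones differ at some row
  up to \<open>N\<close>.\<close>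

lemma disjoint_cylinders: "disjoint_family_on (cylinder N) (interlacing_seqs N lam)"
  unfolding disjoint_family_on_def
proof (intro ballI impI)
  fix l l' assume l: "l \<in> interlacing_seqs N lam" "l' \<in> interlacing_seqs N lam" "l \<noteq> l'"
  have "\<exists>i\<le>N. l i \<noteq> l' i"
  proof (rule ccontr)
    assume "\<not> ?thesis"
    hence "l = l'" using l(1,2)
      by (intro PiE_ext[of l "{0..N}" "\<lambda>_. partitions" l']) (auto simp: interlacing_seqs_def)
    with l(3) show False by simp
  qed
  then obtain i where "i \<le> N" "l i \<noteq> l' i" by blast
  thus "cylinder N l \<inter> cylinder N l' = {}" by (auto simp: cylinder_def)
qed

text \<open>Summing the level identity over all sequences with top row \<open>lam\<close> gives the
  probability of \<open>lam\<close> as \<open>h lam\<close> times its Schur value; dividing by it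
  yields the conditional law.\<close>

lemma gibbs_levels_imp_gibbs:
  assumes c: "\<forall>i\<ge>1. c i \<ge> 0" and pM: "prob_space M" and sM: "sets M = sets array_space"
    and lev: "\<And>N. N \<ge> 1 \<Longrightarrow> gibbs_level c N M"
  shows "M \<in> gibbs c"
proof -
  interpret prob_space M by (rule pM)
  have spM: "space M = arrays" using sM sets_eq_imp_space_eq space_array_space by metis
  have "schur c N lam \<noteq> 0 \<and>
        (\<forall>l. (\<forall>i\<le>N. l i \<in> partitions) \<and> l 0 = empty_part \<and> l N = lam \<longrightarrow>
           cond_prob M (\<lambda>x. \<forall>i\<in>{1..<N}. x i = l i) (\<lambda>x. x N = lam)
             = seq_weight c N l / schur c N lam)"
    if N: "N \<ge> 1" and lam: "lam \<in> partitions" and pos: "measure M {x \<in> space M. x N = lam} > 0" for N lam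
  proof -
    from lev[OF N] obtain h where
      h: "\<And>l. \<forall>i\<le>N. l i \<in> partitions \<Longrightarrow> l 0 = empty_part \<Longrightarrow>
            emeasure M (cylinder N l) = h (l N) * ennreal (seq_weight c N l)"
      unfolding gibbs_level_def by blast
    define m where "m = measure M {x \<in> arrays. x N = lam}"
    have m: "m > 0" using pos by (simp add: m_def spM)
    have "ennreal m = emeasure M (\<Union>l\<in>interlacing_seqs N lam. cylinder N l)"
      unfolding m_def emeasure_eq_measure[symmetric] row_eq_UN_cylinder[OF lam] ..
    also have "\<dots> = (\<Sum>l\<in>interlacing_seqs N lam. emeasure M (cylinder N l))"
      by (rule sum_emeasure[symmetric])
         (auto simp: sM sets_cylinder disjoint_cylinders finite_interlacing_seqs)
    also have "\<dots> = (\<Sum>l\<in>interlacing_seqs N lam. h lam * ennreal (seq_weight c N l))"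
      by (intro sum.cong refl) (subst h, auto simp: interlacing_seqs_def)
    also have "\<dots> = h lam * ennreal (schur c N lam)"
      unfolding schur_def sum_distrib_left[symmetric]
      by (subst sum_ennreal) (auto simp: seq_weight_nonneg[OF c])
    finally have m_eq: "ennreal m = h lam * ennreal (schur c N lam)" .
    \<comment> \<open>A zero Schur value would make the product 0 even for infinite
      \<open>h lam\<close>, against \<open>m > 0\<close>. Once it is positive, an infinite
      \<open>h lam\<close> would contradict the finiteness of \<open>m\<close>.\<close>
    have S: "schur c N lam > 0"
    proof (rule ccontr)
      assume "\<not> ?thesis"
      hence "schur c N lam = 0" using schur_nonneg[OF c, of N lam] by simp
      thus False using m_eq m by simp
    qed
    have "h lam \<noteq> \<top>"
      using m_eq S by (auto simp: ennreal_top_mult)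
    then obtain r where r: "h lam = ennreal r" "r \<ge> 0" by (cases "h lam") auto
    have mr: "m = r * schur c N lam"
      using m_eq m S r by (simp add: ennreal_mult[symmetric])
    have "cond_prob M (\<lambda>x. \<forall>i\<in>{1..<N}. x i = l i) (\<lambda>x. x N = lam) = seq_weight c N l / schur c N lam"
      if l: "\<forall>i\<le>N. l i \<in> partitions" "l 0 = empty_part" "l N = lam" for l
    proof -
      note cyl = cylinder_eq[of N l, OF N l(2)]
      have "ennreal (measure M (cylinder N l)) = ennreal (r * seq_weight c N l)"
        using h[OF l(1,2)] r l(3) seq_weight_nonneg[OF c, of N l]
        by (simp add: emeasure_eq_measure ennreal_mult)
      hence "measure M (cylinder N l) = r * seq_weight c N l"
        using r seq_weight_nonneg[OF c, of N l] by simp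
      hence "cond_prob M (\<lambda>x. \<forall>i\<in>{1..<N}. x i = l i) (\<lambda>x. x N = lam) = r * seq_weight c N l / m"
        by (simp add: cond_prob_def spM cyl l(3) m_def)
      moreover have "r \<noteq> 0" using mr m by auto
      ultimately show ?thesis using S by (simp add: mr)
    qed
    thus ?thesis using S by auto
  qed
  thus ?thesis using pM sM by (simp add: gibbs_def)
qed

text \<open>The cylinder is split over the value \<open>nu\<close> of row \<open>N + 1\<close>. The
  branching factor from row \<open>N\<close> to \<open>nu\<close> is absorbed into a new factor, a
  sum over \<open>nu\<close> that depends on row \<open>N\<close> only.\<close>

lemma gibbs_level_Suc:
  assumes c: "\<forall>i\<ge>1. c i \<ge> 0" and sM: "sets M = sets array_space"
    and lev: "gibbs_level c (Suc N) M"
  shows "gibbs_level c N M"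
proof -
  from lev obtain h where
    h: "\<And>l. \<forall>i\<le>Suc N. l i \<in> partitions \<Longrightarrow> l 0 = empty_part \<Longrightarrow>
          emeasure M (cylinder (Suc N) l) = h (l (Suc N)) * ennreal (seq_weight c (Suc N) l)"
    unfolding gibbs_level_def by blast
  have "emeasure M (cylinder N l) =
      (\<integral>\<^sup>+nu. h nu * ennreal (skew_schur1 nu (l N) (c (Suc N))) \<partial>count_space partitions) *
      ennreal (seq_weight c N l)"
    if l: "\<forall>i\<le>N. l i \<in> partitions" "l 0 = empty_part" for l
  proof -
    have "cylinder N l = (\<Union>nu\<in>partitions. cylinder (Suc N) (l(Suc N := nu)))"
    proof (intro equalityI subsetI)
      fix x assume "x \<in> cylinder N l"
      hence "x \<in> cylinder (Suc N) (l(Suc N := x (Suc N)))" "x (Suc N) \<in> partitions"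
        unfolding cylinder_def by (auto simp: le_Suc_eq, auto simp: arrays_def)
      thus "x \<in> (\<Union>nu\<in>partitions. cylinder (Suc N) (l(Suc N := nu)))" by blast
    next
      fix x assume "x \<in> (\<Union>nu\<in>partitions. cylinder (Suc N) (l(Suc N := nu)))"
      then obtain nu where x: "x \<in> arrays" "\<And>i. i \<le> Suc N \<Longrightarrow> x i = (l(Suc N := nu)) i"
        by (auto simp: cylinder_def)
      have "x i = l i" if "i \<le> N" for i using x(2)[of i] that by simp
      with x(1) show "x \<in> cylinder N l" by (simp add: cylinder_def)
    qed
    moreover have "disjoint_family_on (\<lambda>nu. cylinder (Suc N) (l(Suc N := nu))) partitions"
      by (auto simp: disjoint_family_on_def cylinder_def)
    ultimately have "emeasure M (cylinder N l) =
        (\<integral>\<^sup>+nu. emeasure M (cylinder (Suc N) (l(Suc N := nu))) \<partial>count_space partitions)"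
      by (simp add: emeasure_UN_countable sM sets_cylinder countable_partitions)
    also have "\<dots> = (\<integral>\<^sup>+nu. h nu * ennreal (skew_schur1 nu (l N) (c (Suc N))) * ennreal (seq_weight c N l)
        \<partial>count_space partitions)"
    proof (rule nn_integral_cong)
      fix nu assume nu: "nu \<in> space (count_space partitions)"
      have skew: "skew_schur1 nu (l N) (c (Suc N)) \<ge> 0"
        using c by (simp add: skew_schur1_def)
      from nu have "emeasure M (cylinder (Suc N) (l(Suc N := nu))) =
          h nu * ennreal (seq_weight c (Suc N) (l(Suc N := nu)))"
        using l by (subst h) (auto simp: le_Suc_eq)
      also have "seq_weight c (Suc N) (l(Suc N := nu)) =
          seq_weight c N (l(Suc N := nu)) * skew_schur1 nu (l N) (c (Suc N))"
        by (simp add: seq_weight_def)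
      also have "seq_weight c N (l(Suc N := nu)) = seq_weight c N l"
        by (rule seq_weight_cong) auto
      finally show "emeasure M (cylinder (Suc N) (l(Suc N := nu))) =
          h nu * ennreal (skew_schur1 nu (l N) (c (Suc N))) * ennreal (seq_weight c N l)"
        using seq_weight_nonneg[OF c, of N l] skew by (simp only: ennreal_mult mult_ac)
    qed
    also have "\<dots> = (\<integral>\<^sup>+nu. h nu * ennreal (skew_schur1 nu (l N) (c (Suc N))) \<partial>count_space partitions) *
        ennreal (seq_weight c N l)"
      by (rule nn_integral_multc) simp
    finally show ?thesis .
  qed
  thus ?thesis unfolding gibbs_level_def
    by (intro exI[of _ "\<lambda>lam. \<integral>\<^sup>+nu. h nu * ennreal (skew_schur1 nu lam (c (Suc N))) \<partial>count_space partitions"]) auto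
qed

section \<open>Random updates of one row\<close>

text \<open>Support in \<open>arrays\<close> ensures that the restriction to \<open>arrays\<close>
  loses no mass.\<close>

lemma array_measure:
  assumes "set_pmf P \<subseteq> arrays"
  shows sets_array_measure: "sets (array_measure P) = sets array_space"
    and emeasure_array_measure:
      "A \<in> sets array_space \<Longrightarrow> emeasure (array_measure P) A = emeasure (measure_pmf P) A"
    and prob_space_array_measure: "prob_space (array_measure P)"
proof -
  show s: "sets (array_measure P) = sets array_space" by (simp add: array_measure_def)
  have id: "(\<lambda>x. x) \<in> measurable (restrict_space (measure_pmf P) arrays) array_space"
    by (auto simp: measurable_def space_restrict_space space_array_space sets_restrict_space)
  show e: "emeasure (array_measure P) A = emeasure (measure_pmf P) A" if A: "A \<in> sets array_space" for A
  proof -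
    have "A \<subseteq> arrays" using A by (simp add: sets_array_space_iff)
    thus ?thesis unfolding array_measure_def using A
      by (simp add: emeasure_distr[OF id A] space_restrict_space emeasure_restrict_space Int_absorb2)
  qed
  have "emeasure (array_measure P) (space (array_measure P)) = emeasure (measure_pmf P) arrays"
    using e[OF sets.top] by (simp add: sets_eq_imp_space_eq[OF s] space_array_space)
  also have "\<dots> = 1"
    using assms by (intro measure_pmf.emeasure_eq_1_AE) (auto simp: AE_measure_pmf_iff)
  finally show "prob_space (array_measure P)" by (rule prob_spaceI)
qed

section \<open>Changing one row of an array\<close>

lemma rows_between_partition:
  assumes "nu \<in> partitions" "kap \<in> rows_between mu nu"
  shows "kap \<in> partitions"
proof -
  have "antimono kap"
    using assms(2) unfolding rows_between_def interlace_def
    by (intro decseq_SucI) (auto intro: le_trans)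
  moreover have "{i. kap i \<noteq> 0} \<subseteq> {i. nu i \<noteq> 0}"
  proof
    fix i assume "i \<in> {i. kap i \<noteq> 0}"
    moreover have "kap i \<le> nu i" using assms(2) by (simp add: rows_between_def interlace_def)
    ultimately show "i \<in> {i. nu i \<noteq> 0}" by auto
  qed
  ultimately show ?thesis
    using assms(1) by (auto simp: partitions_def intro: finite_subset)
qed

text \<open>Only the two interlacing relations that involve row \<open>j\<close> change, and
  \<open>j \<ge> 1\<close> keeps row 0 empty.\<close>

lemma fun_upd_in_arrays_iff:
  assumes "x \<in> arrays" "j \<ge> 1"
  shows "x(j := kap) \<in> arrays \<longleftrightarrow> kap \<in> rows_between (x (j - 1)) (x (j + 1))"
proof
  assume *: "x(j := kap) \<in> arrays"
  hence "(x(j := kap)) (j - 1) \<prec>\<prec> (x(j := kap)) (Suc (j - 1))" "(x(j := kap)) j \<prec>\<prec> (x(j := kap)) (Suc j)"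
    unfolding arrays_def by blast+
  thus "kap \<in> rows_between (x (j - 1)) (x (j + 1))"
    using assms(2) by (auto simp: rows_between_def split: if_splits)
next
  assume k: "kap \<in> rows_between (x (j - 1)) (x (j + 1))"
  have "kap \<in> partitions"
    by (rule rows_between_partition[OF _ k]) (use assms in \<open>auto simp: arrays_def\<close>)
  moreover have "(x(j := kap)) i \<prec>\<prec> (x(j := kap)) (Suc i)" for i
    using k assms by (cases "i = j"; cases "Suc i = j") (auto simp: rows_between_def arrays_def)
  ultimately show "x(j := kap) \<in> arrays"
    using assms by (auto simp: arrays_def)
qed

lemma array_row_between:
  assumes "x \<in> arrays" "j \<ge> 1"
  shows "x j \<in> rows_between (x (j - 1)) (x (j + 1))"
  using fun_upd_in_arrays_iff[OF assms, of "x j"] assms(1) by simp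

lemma sets_fun_upd_vimage:
  assumes A: "A \<in> sets array_space"
  shows "{x \<in> arrays. x(j := kap) \<in> A} \<in> sets array_space"
proof (cases "kap \<in> partitions")
  case True
  let ?P = "PiM UNIV (\<lambda>_::nat. count_space partitions)"
  have "(\<lambda>x. x(j := kap)) \<in> measurable ?P ?P"
    by (rule measurable_fun_upd[where J=UNIV]) (use True in auto)
  hence "(\<lambda>x. x(j := kap)) \<in> measurable array_space ?P"
    unfolding array_space_def by (rule measurable_restrict_space1)
  from measurable_sets[OF this, of A] A show ?thesis
    by (simp add: sets_array_space_iff space_array_space vimage_def Int_def conj_commute)
next
  case False
  have "x(j := kap) \<notin> A" for x
  proof
    assume "x(j := kap) \<in> A"
    hence "x(j := kap) \<in> arrays" using A by (auto simp: sets_array_space_iff)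
    hence "(x(j := kap)) j \<in> partitions" unfolding arrays_def by blast
    with False show False by simp
  qed
  thus ?thesis by simp
qed

text \<open>Row \<open>j\<close> enters exactly the factors with index \<open>j\<close> and
  \<open>j + 1\<close>, both present when \<open>N \<ge> j + 1\<close>.\<close>

lemma seq_weight_split:
  assumes "j \<ge> 1" "N \<ge> j + 1"
  shows "seq_weight c N l = skew_schur1 (l j) (l (j - 1)) (c j) * skew_schur1 (l (j + 1)) (l j) (c (j + 1)) *
     (\<Prod>i\<in>{1..N} - {j, j + 1}. skew_schur1 (l i) (l (i - 1)) (c i))"
proof -
  have "seq_weight c N l = (\<Prod>i\<in>{j, j + 1}. skew_schur1 (l i) (l (i - 1)) (c i)) *
      (\<Prod>i\<in>{1..N} - {j, j + 1}. skew_schur1 (l i) (l (i - 1)) (c i))"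
    unfolding seq_weight_def using assms by (subst prod.subset_diff[of "{j, j + 1}"]) (auto simp: mult.commute)
  thus ?thesis by simp
qed

text \<open>The part of the argument common to both Markov maps. The condition on supports ensures
  that an updated array is again an array.\<close>

locale row_update =
  fixes j :: nat and T :: "nat \<Rightarrow> nat \<Rightarrow> nat \<Rightarrow> nat pmf"
  assumes j: "j \<ge> 1"
    and set_T: "\<And>a b k. a \<le> k \<Longrightarrow> k \<le> b \<Longrightarrow> set_pmf (T a b k) \<subseteq> {a..b}"
begin

definition update_pmf :: "(nat \<Rightarrow> nat \<Rightarrow> nat) \<Rightarrow> (nat \<Rightarrow> nat \<Rightarrow> nat) pmf" where
  "update_pmf x = map_pmf (\<lambda>kap. x(j := kap)) (row_law T j (x (j - 1)) (x j) (x (j + 1)))"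

lemma array_bounds:
  assumes "x \<in> arrays"
  shows "\<forall>i\<ge>j - 1. x (j - 1) i = 0" "\<forall>i>j. x (j + 1) i = 0"
  using arrays_eq_0[OF assms] by auto

lemma set_row_law:
  assumes x: "x \<in> arrays"
  shows "set_pmf (row_law T j (x (j - 1)) (x j) (x (j + 1))) \<subseteq> rows_between (x (j - 1)) (x (j + 1))"
  using set_T array_row_between[OF x j]
  unfolding row_law_def rows_between_eq_PiE_dflt[OF j array_bounds[OF x]]
  by (auto simp: set_Pi_pmf PiE_dflt_def) (meson atLeastAtMost_iff subsetD)+

lemma set_update_pmf: "x \<in> arrays \<Longrightarrow> set_pmf (update_pmf x) \<subseteq> arrays"
  using set_row_law[of x] j by (auto simp: update_pmf_def fun_upd_in_arrays_iff)

text \<open>The sum over target rows has coefficients that depend on three rows only, a form suited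
  to proving measurability in the starting array.\<close>

lemma emeasure_update:
  assumes x: "x \<in> arrays" and A: "A \<in> sets array_space"
  shows "emeasure (array_measure (update_pmf x)) A = (\<Sum>kap\<in>rows_between (x (j - 1)) (x (j + 1)).
    indicator {y \<in> arrays. y(j := kap) \<in> A} x * ennreal (pmf (row_law T j (x (j - 1)) (x j) (x (j + 1))) kap))"
proof -
  let ?R = "rows_between (x (j - 1)) (x (j + 1))" and ?p = "row_law T j (x (j - 1)) (x j) (x (j + 1))"
  have fin: "finite ?R" by (rule finite_rows_between[OF j array_bounds[OF x]])
  have "emeasure (array_measure (update_pmf x)) A = emeasure (measure_pmf ?p) {kap. x(j := kap) \<in> A}"
    by (simp add: emeasure_array_measure[OF set_update_pmf[OF x] A])
       (simp add: update_pmf_def vimage_def)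
  \<comment> \<open>A target row outside \<open>?R\<close> does not give an array, hence no element
    of \<open>A\<close>.\<close>
  also have "{kap. x(j := kap) \<in> A} = {kap \<in> ?R. x(j := kap) \<in> A}"
    using A fun_upd_in_arrays_iff[OF x j] by (auto simp: sets_array_space_iff)
  also have "emeasure (measure_pmf ?p) \<dots> = (\<Sum>kap\<in>{kap \<in> ?R. x(j := kap) \<in> A}. ennreal (pmf ?p kap))"
    using fin by (simp add: emeasure_measure_pmf_finite)
  also have "\<dots> = (\<Sum>kap\<in>?R. indicator {y \<in> arrays. y(j := kap) \<in> A} x * ennreal (pmf ?p kap))"
    using x fin by (intro sum.mono_neutral_cong_left) (auto simp: indicator_def)
  finally show ?thesis .
qed

lemma update_measurable:
  "(\<lambda>x. array_measure (update_pmf x)) \<in> measurable array_space (subprob_algebra array_space)"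
proof (rule measurable_subprob_algebra)
  fix A assume A: "A \<in> sets array_space"
  \<comment> \<open>With the three rows frozen as a parameter, each summand is a measurable
    indicator times a constant; the parameter ranges over a countable set.\<close>
  define f where "f = (\<lambda>(mu, k, nu) x. \<Sum>kap\<in>rows_between mu nu.
      indicator {y \<in> arrays. y(j := kap) \<in> A} x * ennreal (pmf (row_law T j mu k nu) kap))"
  have f: "f t \<in> borel_measurable array_space" for t
    unfolding f_def using sets_fun_upd_vimage[OF A]
    by (cases t) (auto intro!: borel_measurable_sum borel_measurable_times_ennreal borel_measurable_indicator)
  have g: "(\<lambda>x. (x (j - 1), x j, x (j + 1))) \<in>
      measurable array_space (count_space (partitions \<times> partitions \<times> partitions))"
  proof -
    have "count_space (partitions \<times> partitions \<times> partitions) =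
        count_space partitions \<Otimes>\<^sub>M (count_space partitions \<Otimes>\<^sub>M count_space partitions)"
      by (simp add: pair_measure_countable countable_partitions)
    thus ?thesis by (simp only:) (intro measurable_Pair measurable_row)
  qed
  have "(\<lambda>x. f (x (j - 1), x j, x (j + 1)) x) \<in> borel_measurable array_space"
    by (rule measurable_compose_countable'[OF f g]) (intro countable_SIGMA countable_partitions)
  moreover have "emeasure (array_measure (update_pmf x)) A = f (x (j - 1), x j, x (j + 1)) x"
    if "x \<in> space array_space" for x
    using that emeasure_update[OF _ A, of x] by (simp add: f_def space_array_space)
  ultimately show "(\<lambda>x. emeasure (array_measure (update_pmf x)) A) \<in> borel_measurable array_space"
    by (simp cong: measurable_cong)
qed (simp_all add: space_array_space set_update_pmf sets_array_measure
       prob_space_imp_subprob_space prob_space_array_measure)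

text \<open>Here the sum runs over starting rows, while in \<open>emeasure_update\<close> it runs
  over target rows. Either sum has at most one nonzero term, and the present form makes integration
  against \<open>M\<close> produce probabilities of cylinders.\<close>

lemma emeasure_update_cylinder:
  assumes x: "x \<in> arrays" and N: "N \<ge> j + 1" and l: "l j \<in> rows_between (l (j - 1)) (l (j + 1))"
  shows "emeasure (array_measure (update_pmf x)) (cylinder N l) =
    (\<Sum>kap\<in>rows_between (l (j - 1)) (l (j + 1)).
       indicator (cylinder N (l(j := kap))) x *
       ennreal (pmf (row_law T j (l (j - 1)) kap (l (j + 1))) (l j)))"
proof (cases "\<forall>i\<le>N. i \<noteq> j \<longrightarrow> x i = l i")
  case True
  hence nb: "x (j - 1) = l (j - 1)" "x (j + 1) = l (j + 1)" using N j by auto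
  let ?R = "rows_between (l (j - 1)) (l (j + 1))" and ?p = "row_law T j (l (j - 1)) (x j) (l (j + 1))"
  have fin: "finite ?R"
    using finite_rows_between[OF j array_bounds[OF x]] nb by simp
  have 1: "x(j := kap) \<in> cylinder N l \<longleftrightarrow> kap = l j" if "kap \<in> ?R" for kap
    using True N that x fun_upd_in_arrays_iff[OF x j, of kap] nb by (auto simp: cylinder_def)
  have 2: "x \<in> cylinder N (l(j := kap)) \<longleftrightarrow> kap = x j" for kap
    using True N x by (auto simp: cylinder_def)
  have "emeasure (array_measure (update_pmf x)) (cylinder N l) =
      (\<Sum>kap\<in>?R. if kap = l j then ennreal (pmf ?p (l j)) else 0)"
    unfolding emeasure_update[OF x sets_cylinder] nb
    by (rule sum.cong) (use x 1 in \<open>auto simp: indicator_def\<close>)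
  also have "\<dots> = ennreal (pmf ?p (l j))"
    using fin l by simp
  also have "\<dots> = (\<Sum>kap\<in>?R. if kap = x j then ennreal (pmf ?p (l j)) else 0)"
    using fin array_row_between[OF x j] nb by simp
  also have "\<dots> = (\<Sum>kap\<in>?R. indicator (cylinder N (l(j := kap))) x *
       ennreal (pmf (row_law T j (l (j - 1)) kap (l (j + 1))) (l j)))"
    by (rule sum.cong) (auto simp: indicator_def 2)
  finally show ?thesis .
next
  case False
  hence "x(j := kap) \<notin> cylinder N l" "x \<notin> cylinder N (l(j := kap))" for kap
    by (auto simp: cylinder_def)
  thus ?thesis unfolding emeasure_update[OF x sets_cylinder] by simp
qed

lemma bind_update_gibbs:
  assumes c: "\<forall>i\<ge>1. c i \<ge> 0"
    and T: "\<And>a b y. a \<le> y \<Longrightarrow> y \<le> b \<Longrightarrow>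
      (\<Sum>k=a..b. c j ^ (k - a) * c (j + 1) ^ (b - k) * pmf (T a b k) y) =
        c (j + 1) ^ (y - a) * c j ^ (b - y)"
    and M: "M \<in> gibbs c"
  shows "M \<bind> (\<lambda>x. array_measure (update_pmf x)) \<in> gibbs (swap_params j c)"
proof -
  let ?K = "\<lambda>x. array_measure (update_pmf x)" and ?c' = "swap_params j c"
  let ?M' = "M \<bind> ?K"
  from M interpret prob_space M by (simp add: gibbs_def)
  have sM[measurable_cong]: "sets M = sets array_space" using M by (simp add: gibbs_def)
  hence spM: "space M = arrays" using sets_eq_imp_space_eq space_array_space by metis
  have K: "?K \<in> measurable M (subprob_algebra array_space)"
    using update_measurable by (simp cong: measurable_cong_sets add: measurable_cong_sets[OF sM refl])
  have c': "\<forall>i\<ge>1. ?c' i \<ge> 0"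
    using c j by (auto simp: swap_params_def)
  have sM': "sets ?M' = sets array_space"
    using not_empty by (intro sets_bind) (simp_all add: spM set_update_pmf sets_array_measure)
  have pM': "prob_space ?M'"
    by (rule prob_space_bind[OF AE_I2 K]) (simp add: spM set_update_pmf prob_space_array_measure)
  \<comment> \<open>From level \<open>j + 1\<close> on, both swapped parameters occur in the weight
    and row \<open>j\<close> lies strictly below the top row.\<close>
  have high: "gibbs_level ?c' N ?M'" if N: "N \<ge> j + 1" for N
  proof -
    have "gibbs_level c N M" using gibbs_imp_gibbs_level[OF c M, of N] N by simp
    then obtain h where
      h: "\<And>l. \<forall>i\<le>N. l i \<in> partitions \<Longrightarrow> l 0 = empty_part \<Longrightarrow>
            emeasure M (cylinder N l) = h (l N) * ennreal (seq_weight c N l)"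
      unfolding gibbs_level_def by blast
    have "emeasure ?M' (cylinder N l) = h (l N) * ennreal (seq_weight ?c' N l)"
      if l: "\<forall>i\<le>N. l i \<in> partitions" "l 0 = empty_part" for l
    proof (cases "\<forall>i<N. l i \<prec>\<prec> l (Suc i)")
      case False
      then obtain i where i: "i < N" "\<not> l i \<prec>\<prec> l (Suc i)" by blast
      \<comment> \<open>Both sides vanish: no array passes through a sequence that fails to
        interlace.\<close>
      have "cylinder N l = {}"
      proof -
        have "x \<notin> cylinder N l" for x
        proof
          assume "x \<in> cylinder N l"
          hence "x \<in> arrays" "x i = l i" "x (Suc i) = l (Suc i)"
            using i(1) by (auto simp: cylinder_def)
          moreover from this have "x i \<prec>\<prec> x (Suc i)" unfolding arrays_def by blast
          ultimately have "l i \<prec>\<prec> l (Suc i)" by simp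
          with i(2) show False by simp
        qed
        thus ?thesis by blast
      qed
      thus ?thesis using seq_weight_not_interlacing[of i N l ?c'] i by simp
    next
      case True
      let ?mu = "l (j - 1)" and ?nu = "l (j + 1)"
      let ?R = "rows_between ?mu ?nu"
      \<comment> \<open>Only the rows of \<open>l\<close> up to \<open>N\<close> are known to
        interlace, so the zeros come from a separate induction and not from
        \<open>arrays_eq_0\<close>.\<close>
      have zero: "l k i = 0" if "k \<le> N" "k \<le> i" for k i
        using that
      proof (induction k arbitrary: i)
        case (Suc k)
        then obtain n where n: "i = Suc n" "n \<ge> k" by (cases i) auto
        have "l (Suc k) (Suc n) \<le> l k n" using True Suc.prems by (simp add: interlace_def)
        with Suc n show ?case by simp
      qed (simp add: l(2))
      have mu0: "\<forall>i\<ge>j - 1. ?mu i = 0" and nu0: "\<forall>i>j. ?nu i = 0"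
        using N by (auto intro: zero)
      have lj: "l j \<in> ?R"
        using True[rule_format, of "j - 1"] True[rule_format, of j] N j by (simp add: rows_between_def)
      \<comment> \<open>\<open>W\<close> collects the factors that involve neither row
        \<open>j\<close> nor the parameters \<open>c j\<close> and \<open>c (j + 1)\<close>.\<close>
      define W where "W = (\<Prod>i\<in>{1..N} - {j, j + 1}. skew_schur1 (l i) (l (i - 1)) (c i))"
      have W: "W \<ge> 0"
        unfolding W_def using c by (intro prod_nonneg) (auto simp: skew_schur1_def)
      have w: "seq_weight c N (l(j := kap)) =
          skew_schur1 kap ?mu (c j) * skew_schur1 ?nu kap (c (j + 1)) * W" for kap
      proof -
        have "(\<Prod>i\<in>{1..N} - {j, j + 1}. skew_schur1 ((l(j := kap)) i) ((l(j := kap)) (i - 1)) (c i)) = W"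
          unfolding W_def by (rule prod.cong) auto
        moreover have "(l(j := kap)) (j - 1) = ?mu" "(l(j := kap)) j = kap" "(l(j := kap)) (j + 1) = ?nu"
          using j by auto
        ultimately show ?thesis by (simp only: seq_weight_split[OF j N])
      qed
      have w': "seq_weight ?c' N l = skew_schur1 (l j) ?mu (c (j + 1)) * skew_schur1 ?nu (l j) (c j) * W"
      proof -
        have "(\<Prod>i\<in>{1..N} - {j, j + 1}. skew_schur1 (l i) (l (i - 1)) (?c' i)) = W"
          unfolding W_def by (rule prod.cong) (auto simp: swap_params_def)
        thus ?thesis by (simp add: seq_weight_split[OF j N] swap_params_def)
      qed
      have nn: "seq_weight c N (l(j := kap)) \<ge> 0" for kap by (rule seq_weight_nonneg[OF c])
      have "emeasure ?M' (cylinder N l) = (\<integral>\<^sup>+x. emeasure (?K x) (cylinder N l) \<partial>M)"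
        by (rule emeasure_bind[OF not_empty K sets_cylinder])
      also have "\<dots> = (\<integral>\<^sup>+x. (\<Sum>kap\<in>?R. indicator (cylinder N (l(j := kap))) x *
          ennreal (pmf (row_law T j ?mu kap ?nu) (l j))) \<partial>M)"
        by (intro nn_integral_cong emeasure_update_cylinder[OF _ N lj]) (simp add: spM)
      also have "\<dots> = (\<Sum>kap\<in>?R. emeasure M (cylinder N (l(j := kap))) *
          ennreal (pmf (row_law T j ?mu kap ?nu) (l j)))"
        using sets_cylinder
        by (subst nn_integral_sum) (auto simp: nn_integral_multc sM)
      also have "\<dots> = (\<Sum>kap\<in>?R. h (l N) *
          ennreal (seq_weight c N (l(j := kap)) * pmf (row_law T j ?mu kap ?nu) (l j)))"
      proof (rule sum.cong)
        fix kap assume kap: "kap \<in> ?R"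
        have "kap \<in> partitions"
          by (rule rows_between_partition[OF _ kap]) (use l N in auto)
        \<comment> \<open>As \<open>j < N\<close>, replacing row \<open>j\<close> keeps the top row,
          so the same value of \<open>h\<close> appears for every \<open>kap\<close>.\<close>
        hence "emeasure M (cylinder N (l(j := kap))) = h (l N) * ennreal (seq_weight c N (l(j := kap)))"
          using l N j by (subst h) auto
        thus "emeasure M (cylinder N (l(j := kap))) * ennreal (pmf (row_law T j ?mu kap ?nu) (l j)) =
            h (l N) * ennreal (seq_weight c N (l(j := kap)) * pmf (row_law T j ?mu kap ?nu) (l j))"
          using nn[of kap] by (simp add: ennreal_mult mult_ac)
      qed simp
      also have "\<dots> = h (l N) *
          ennreal (\<Sum>kap\<in>?R. seq_weight c N (l(j := kap)) * pmf (row_law T j ?mu kap ?nu) (l j))"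
        unfolding sum_distrib_left[symmetric] using nn by (subst sum_ennreal) auto
      also have "(\<Sum>kap\<in>?R. seq_weight c N (l(j := kap)) * pmf (row_law T j ?mu kap ?nu) (l j)) =
          W * (\<Sum>kap\<in>?R. skew_schur1 kap ?mu (c j) * skew_schur1 ?nu kap (c (j + 1)) *
            pmf (row_law T j ?mu kap ?nu) (l j))"
        by (simp add: w sum_distrib_left mult_ac)
      also have "(\<Sum>kap\<in>?R. skew_schur1 kap ?mu (c j) * skew_schur1 ?nu kap (c (j + 1)) *
            pmf (row_law T j ?mu kap ?nu) (l j)) = skew_schur1 (l j) ?mu (c (j + 1)) * skew_schur1 ?nu (l j) (c j)"
        by (rule row_law_swap[OF j mu0 nu0 _ lj]) (rule T)
      also have "W * \<dots> = seq_weight ?c' N l"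
        by (simp add: w')
      finally show ?thesis .
    qed
    thus ?thesis unfolding gibbs_level_def by blast
  qed
  have "gibbs_level ?c' N ?M'" for N
  proof (cases "N \<ge> j + 1")
    case True
    then show ?thesis by (rule high)
  next
    case False
    hence "N \<le> j + 1" by simp
    thus ?thesis
    proof (induction rule: inc_induct)
      case base
      show ?case by (rule high) simp
    next
      case (step n)
      show ?case by (rule gibbs_level_Suc[OF c' sM' step.IH])
    qed
  qed
  thus ?thesis by (intro gibbs_levels_imp_gibbs c' pM' sM')
qed

end

text \<open>Each map is an instance of \<open>row_update\<close>, with the one-coordinate identity
  supplied by \<open>L_step_swap\<close> or \<open>R_step_swap\<close>. The order of
  \<open>c j\<close> and \<open>c (j + 1)\<close> keeps the parameter in
  \<open>[0, 1]\<close>.\<close>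

theorem proposition4p7:
  fixes c :: "nat \<Rightarrow> real" and j :: nat
  assumes "\<And>i. i \<ge> 1 \<Longrightarrow> c i \<ge> 0"
    and "j \<ge> 1"
  shows "(c j \<ge> c (j + 1) \<and> c j \<noteq> 0 \<longrightarrow>
            (\<forall>M \<in> gibbs c. L_map j (c (j + 1) / c j) M \<in> gibbs (swap_params j c))) \<and>
         (c j \<le> c (j + 1) \<and> c (j + 1) \<noteq> 0 \<longrightarrow>
            (\<forall>M \<in> gibbs c. R_map j (c j / c (j + 1)) M \<in> gibbs (swap_params j c)))"
proof (intro conjI impI ballI; elim conjE)
  have c: "\<forall>i\<ge>1. c i \<ge> 0" using assms(1) by blast
  have nn: "c j \<ge> 0" "c (j + 1) \<ge> 0" using assms by auto
  have spM: "space M = arrays" if "M \<in> gibbs c" for M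
    using that sets_eq_imp_space_eq[of M array_space] by (simp add: gibbs_def space_array_space)
  fix M assume M: "M \<in> gibbs c"
  {
    assume *: "c (j + 1) \<le> c j" "c j \<noteq> 0"
    let ?\<alpha> = "c (j + 1) / c j"
    have \<alpha>: "0 \<le> ?\<alpha>" "?\<alpha> \<le> 1" using * nn by (auto simp: field_simps)
    interpret row_update j "L_step ?\<alpha>"
      by standard (use assms(2) set_L_step[OF \<alpha>] in auto)
    \<comment> \<open>The two kernels are only known to agree on arrays, which suffices because
      \<open>arrays\<close> is the space of \<open>M\<close>.\<close>
    have "L_map j ?\<alpha> M = M \<bind> (\<lambda>x. array_measure (update_pmf x))"
      unfolding L_map_def by (rule bind_cong) (simp_all only: spM[OF M] L_pmf_eq update_pmf_def)
    thus "L_map j ?\<alpha> M \<in> gibbs (swap_params j c)"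
      using bind_update_gibbs[OF c _ M] L_step_swap nn * by simp
  next
    assume *: "c j \<le> c (j + 1)" "c (j + 1) \<noteq> 0"
    let ?\<alpha> = "c j / c (j + 1)"
    have \<alpha>: "0 \<le> ?\<alpha>" "?\<alpha> \<le> 1" using * nn by (auto simp: field_simps)
    interpret row_update j "R_step ?\<alpha>"
      by standard (use assms(2) set_R_step[OF \<alpha>] in auto)
    have "R_map j ?\<alpha> M = M \<bind> (\<lambda>x. array_measure (update_pmf x))"
      unfolding R_map_def by (rule bind_cong) (simp_all only: spM[OF M] R_pmf_eq update_pmf_def)
    thus "R_map j ?\<alpha> M \<in> gibbs (swap_params j c)"
      using bind_update_gibbs[OF c _ M] R_step_swap nn * by simp
  }
qed

end
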